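(* Let $\mathcal D$ be the distribution of random $m\times d$ matrices $Z$ with i.i.d. standard Gaussian entries, $m\ge1$. Let $x^*\in\mathbb{S}^{d-1}$, let $\ell(u,w;x,x^* )$ be a loss, $\ell:\mathbb{R}^m\times\mathbb{R}^m\times\mathbb{R}^d\times\mathbb{R}^d\to\mathbb{R}$, locally Lipschitz in $u$, and let $$g_\ell(x,x^* )=\mathbb{E}_{Z\sim\mathcal D}\big[(I-xx^\top)Z^\top\partial_1\ell(Zx,Zx^*;x,x^* )\big].$$ Then for any $x\in\mathbb{S}^{d-1}$ such that $\theta=\theta(x,x^* )\in(0,\pi/2)$ and $$\mathbb{E}_{Z\sim\mathcal D}\big[\operatorname{tr}\big(D_2\partial_1\ell(Zx,Zx^*;x,x^* )\big)\big]<0,$$ we have $$g_\ell(x,x^* )\cdot x^*=-\|g_\ell(x,x^* )\|_2\,\sin\theta .$$ In other words, the RGA property holds at $(x,x^* )$ with $\mu=r=1$.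
   Context: $\mathbb{S}^{d-1}$ is the unit sphere of $\mathbb{R}^d$; $\theta(x,y)=\arccos(x\cdot y)$ for unit vectors. A tangent vector $g(x)\perp x$ is $(\mu,r)$-RGA at $(x,x^* )$ if $g(x)\neq0$ whenever $x\ne x^*$ and $g(x)\cdot x^*\le-\mu\sin^r(\theta(x,x^* ))\|g(x)\|_2$. $\partial_1\ell\in\mathbb{R}^m$ is the gradient of $\ell$ in its first ($\mathbb{R}^m$-valued) argument; where $\ell$ is not differentiable it denotes one fixed measurable, integrable single-valued selection from the Clarke subdifferential in that argument. $D_2\partial_1\ell$ is the $m\times m$ matrix of distributional (weak) derivatives with $(i,j)$ entry $D_{w_j}(\partial_1\ell(u,w;x,x^* ))_i$; the expectation of its $(i,i)$ entry is its pairing with the (nondegenerate Gaussian) joint density $p(u,w)$ of $(Zx,Zx^* )$, i.e. $-\iint(\partial_1\ell(u,w;x,x^* ))_i\,\partial_{w_i}p(u,w)\,du\,dw$. All displayed expectations are assumed finite, and all functions and distributional derivatives are assumed to satisfy the integrability hypotheses needed for Stein's identity $\mathbb{E}[G(p)p]=\mathbb{E}[DG(p)]$, $p$ standard Gaussian ($G$ integrable, $\mathbb{E}[G(p)p]$ exists, $G$ has a distributional derivative). *)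

theory Defs
  imports "HOL-Probability.Probability"
begin

definition angle :: "real ^ 'd \<Rightarrow> real ^ 'd \<Rightarrow> real" where
  "angle x y = arccos (x \<bullet> y)"

(* v is the value g(x) of the vector field; the base of powr is nonnegative
   because the angle lies in [0, pi]. *)
definition RGA :: "real \<Rightarrow> real \<Rightarrow> real ^ 'd \<Rightarrow> real ^ 'd \<Rightarrow> real ^ 'd \<Rightarrow> bool" where
  "RGA \<mu> r v x xs \<longleftrightarrow> v \<bullet> x = 0 \<and> (x \<noteq> xs \<longrightarrow> v \<noteq> 0) \<and>
     v \<bullet> xs \<le> - \<mu> * (sin (angle x xs) powr r) * norm v"

(* The limsup runs over base points y tending to u and step sizes t decreasing to 0. *)
definition clarke_dderiv :: "('a::real_normed_vector \<Rightarrow> real) \<Rightarrow> 'a \<Rightarrow> 'a \<Rightarrow> ereal" where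
  "clarke_dderiv f u h =
     Limsup (nhds u \<times>\<^sub>F at_right 0) (\<lambda>(y, t). ereal ((f (y + t *\<^sub>R h) - f y) / t))"

definition clarke_subdiff :: "('a::real_inner \<Rightarrow> real) \<Rightarrow> 'a \<Rightarrow> 'a set" where
  "clarke_subdiff f u = {v. \<forall>h. ereal (v \<bullet> h) \<le> clarke_dderiv f u h}"

(* Integrability of the selection refers to the Gaussian law and hence to a pair (x, y);
   it is not part of this predicate. *)
definition partial1_selection ::
  "(real ^ 'm \<Rightarrow> real ^ 'm \<Rightarrow> real ^ 'd \<Rightarrow> real ^ 'd \<Rightarrow> real) \<Rightarrow>
   (real ^ 'm \<Rightarrow> real ^ 'm \<Rightarrow> real ^ 'd \<Rightarrow> real ^ 'd \<Rightarrow> real ^ 'm) \<Rightarrow> bool" where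
  "partial1_selection l dl \<longleftrightarrow>
     (\<forall>u w x y.
        if (\<lambda>u'. l u' w x y) differentiable (at u)
        then GDERIV (\<lambda>u'. l u' w x y) u :> dl u w x y
        else dl u w x y \<in> clarke_subdiff (\<lambda>u'. l u' w x y) u) \<and>
     (\<forall>x y. (\<lambda>(u, w). dl u w x y) \<in> borel_measurable borel)"

definition gaussian_matrix :: "(real ^ 'd ^ 'm) measure" where
  "gaussian_matrix =
     distr (\<Pi>\<^sub>M p\<in>(UNIV :: ('m \<times> 'd) set). density lborel std_normal_density) borel
       (\<lambda>z. \<chi> i j. z (i, j))"

lemma measurable_entries_to_matrix:
  "(\<lambda>z. (\<chi> i j. z (i, j)) :: real ^ 'd ^ 'm) \<in>
     borel_measurable (\<Pi>\<^sub>M p\<in>(UNIV :: ('m \<times> 'd) set). density lborel std_normal_density)"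
proof (rule borel_measurable_euclidean_space[THEN iffD2], rule ballI)
  fix b :: "real ^ 'd ^ 'm" assume "b \<in> Basis"
  then obtain i j where b: "b = axis i (axis j 1)"
    by (auto simp: Basis_vec_def)
  have "(\<lambda>z. z (i, j)) \<in> (\<Pi>\<^sub>M p\<in>(UNIV :: ('m \<times> 'd) set). density lborel std_normal_density)
      \<rightarrow>\<^sub>M density lborel std_normal_density"
    by (rule measurable_component_singleton) simp
  then have "(\<lambda>z. z (i, j)) \<in>
      borel_measurable (\<Pi>\<^sub>M p\<in>(UNIV :: ('m \<times> 'd) set). density lborel std_normal_density)"
    by (simp cong: measurable_cong_sets)
  then show "(\<lambda>z. ((\<chi> i j. z (i, j)) :: real ^ 'd ^ 'm) \<bullet> b) \<in>
      borel_measurable (\<Pi>\<^sub>M p\<in>(UNIV :: ('m \<times> 'd) set). density lborel std_normal_density)"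
    by (simp add: b inner_axis)
qed

lemma prob_space_gaussian_matrix: "prob_space (gaussian_matrix :: (real ^ 'd ^ 'm) measure)"
proof -
  interpret product_prob_space "\<lambda>_::'m \<times> 'd. density lborel std_normal_density" UNIV
    by (intro product_prob_spaceI prob_space_normal_density) auto
  show ?thesis
    unfolding gaussian_matrix_def
    by (rule prob_space_distr[OF measurable_entries_to_matrix])
qed

definition tangent_proj :: "real ^ 'd \<Rightarrow> real ^ 'd ^ 'd" where
  "tangent_proj x = mat 1 - (\<chi> i j. x $ i * x $ j)"

definition g_integrand ::
  "(real ^ 'm \<Rightarrow> real ^ 'm \<Rightarrow> real ^ 'd \<Rightarrow> real ^ 'd \<Rightarrow> real ^ 'm) \<Rightarrow>
   real ^ 'd \<Rightarrow> real ^ 'd \<Rightarrow> real ^ 'd ^ 'm \<Rightarrow> real ^ 'd" where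
  "g_integrand dl x xs Z =
     tangent_proj x *v (transpose Z *v dl (Z *v x) (Z *v xs) x xs)"

definition g_loss ::
  "(real ^ 'm \<Rightarrow> real ^ 'm \<Rightarrow> real ^ 'd \<Rightarrow> real ^ 'd \<Rightarrow> real ^ 'm) \<Rightarrow>
   real ^ 'd \<Rightarrow> real ^ 'd \<Rightarrow> real ^ 'd" where
  "g_loss dl x xs = (\<integral>Z. g_integrand dl x xs Z \<partial>gaussian_matrix)"

(* For unit vectors x, xs with c = x . xs, the pairs ((Z x)_i, (Z xs)_i) are independent over i
   and centred Gaussian with covariance matrix [[1, c], [c, 1]]; for |c| < 1 its determinant is
   1 - c^2 and its inverse is [[1, -c], [-c, 1]] / (1 - c^2). The following is the product of
   their m densities. *)
definition joint_density ::
  "real ^ 'd \<Rightarrow> real ^ 'd \<Rightarrow> (real ^ 'm) \<times> (real ^ 'm) \<Rightarrow> real" where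
  "joint_density x xs = (\<lambda>(u, w). let c = x \<bullet> xs in
     (\<Prod>i\<in>UNIV. exp (- ((u $ i)\<^sup>2 - 2 * c * (u $ i) * (w $ i) + (w $ i)\<^sup>2) / (2 * (1 - c\<^sup>2)))
        / (2 * pi * sqrt (1 - c\<^sup>2))))"

definition partial_w ::
  "'m \<Rightarrow> ((real ^ 'm) \<times> (real ^ 'm) \<Rightarrow> real) \<Rightarrow> (real ^ 'm) \<times> (real ^ 'm) \<Rightarrow> real" where
  "partial_w j \<phi> = (\<lambda>(u, w). deriv (\<lambda>t. \<phi> (u, w + t *\<^sub>R axis j 1)) 0)"

(* The matrix of pairings of the distributional derivatives D_{w_j} G_i with a function phi. *)
definition weak_D2 ::
  "(real ^ 'm \<Rightarrow> real ^ 'm \<Rightarrow> real ^ 'm) \<Rightarrow> ((real ^ 'm) \<times> (real ^ 'm) \<Rightarrow> real) \<Rightarrow>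
   real ^ 'm ^ 'm" where
  "weak_D2 G \<phi> = (\<chi> i j. - (\<integral>(u, w). G u w $ i * partial_w j \<phi> (u, w) \<partial>lborel))"

(* E[tr (D_2 G (Z x, Z xs))]: the expectation of a distributional derivative is its pairing
   with the joint density of (Z x, Z xs). *)
definition expected_trace_D2 ::
  "(real ^ 'm \<Rightarrow> real ^ 'm \<Rightarrow> real ^ 'm) \<Rightarrow> real ^ 'd \<Rightarrow> real ^ 'd \<Rightarrow> real" where
  "expected_trace_D2 G x xs = trace (weak_D2 G (joint_density x xs))"

end

theory Submission
  imports Defs
begin

text \<open>
  Let \<open>c = x \<bullet> xs = cos \<theta>\<close>, \<open>s = sin \<theta>\<close> and \<open>xs = c x + s e\<close> with \<open>e\<close> a unit vector orthogonal to \<open>x\<close>.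
  Write \<open>G(u, w)\<close> for the gradient of the loss and \<open>p\<close> for the joint density of
  \<open>(u, w) = (Z x, Z xs)\<close>. The expected gradient \<open>g\<close> satisfies
  \<open>g \<bullet> a = E[G(Z x, Z xs) \<bullet> Z (a - (x \<bullet> a) x)]\<close>, which is \<open>0\<close> for \<open>a = x\<close>.

  If \<open>f\<close> is orthogonal to \<open>x\<close> and \<open>xs\<close>, reflecting the rows of \<open>Z\<close> along \<open>f\<close> preserves the Gaussian law
  and changes the sign of the integrand of \<open>g \<bullet> f\<close>, so \<open>g \<bullet> f = 0\<close>
  (\<open>g_loss_orthogonal_complement\<close>). Hence \<open>g\<close> is a multiple of \<open>e\<close>.

  The multiple is read off from \<open>g \<bullet> xs = E[G(u, w) \<bullet> (w - c u)]\<close>. Since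
  \<open>(w\<^sub>i - c u\<^sub>i) p = - s\<^sup>2 \<partial>p / \<partial>w\<^sub>i\<close>, this expectation is \<open>s\<^sup>2 t\<close>, where
  \<open>t = - \<Sum>\<^sub>i \<integral> G\<^sub>i \<partial>p / \<partial>w\<^sub>i\<close> is the expected trace (\<open>g_loss_inner_eq_trace\<close>). Differentiating only the
  density makes this Stein's identity for the distributional derivative of \<open>G\<close>. Thus \<open>g = t s e\<close>,
  and \<open>t < 0\<close> gives \<open>norm g = - t s\<close> and \<open>g \<bullet> xs = - norm g s\<close>.

  Two facts about the Gaussian law are needed: its invariance under reflections, which comes from the
  orthogonal invariance of Lebesgue measure, and the joint density of \<open>(Z x, Z xs)\<close>
  (\<open>distr_gaussian_matrix_joint_density\<close>), which invariance reduces to two columns of \<open>Z\<close>.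
\<close>

section \<open>Lebesgue measure under orthogonal maps\<close>

text \<open>Uniqueness of Haar measure, normalised on the unit ball \<open>B\<close>. Translation invariance and
  Tonelli's theorem give \<open>\<nu>(B) \<lambda>(A) = \<lambda>(-B) \<nu>(A)\<close> for Lebesgue measure \<open>\<lambda>\<close>, and \<open>-B = B\<close>.\<close>

lemma lborel_eqI_translation_invariant:
  fixes \<nu> :: "'a::euclidean_space measure"
  assumes sets [measurable_cong]: "sets \<nu> = sets borel"
    and "sigma_finite_measure \<nu>"
    and translation: "\<And>y. distr \<nu> borel ((+) y) = \<nu>"
    and ball: "emeasure \<nu> (ball 0 1) = emeasure lborel (ball (0::'a) 1)"
  shows "\<nu> = lborel"
proof (rule measure_eqI)
  show "sets \<nu> = sets lborel" by (simp add: sets)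
  interpret \<nu>: sigma_finite_measure \<nu> by fact
  interpret pair_sigma_finite \<nu> lborel ..
  define B where "B = ball (0::'a) 1"
  have [measurable]: "B \<in> sets borel" by (simp add: B_def)
  have B_diff: "indicator B (x - y) = (indicator B (y - x) :: ennreal)" for x y
    by (auto simp: indicator_def B_def norm_minus_commute)
  fix A assume "A \<in> sets \<nu>"
  then have A[measurable]: "A \<in> sets borel" by (simp add: sets)
  have "emeasure \<nu> B * emeasure lborel A
      = (\<integral>\<^sup>+x. \<integral>\<^sup>+y. indicator B x * indicator A y \<partial>lborel \<partial>\<nu>)"
    by (simp add: nn_integral_cmult nn_integral_multc sets)
  also have "\<dots> = (\<integral>\<^sup>+x. \<integral>\<^sup>+y. indicator B x * indicator A (x + y) \<partial>lborel \<partial>\<nu>)"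
  proof (rule nn_integral_cong)
    fix x :: 'a
    show "(\<integral>\<^sup>+y. indicator B x * indicator A y \<partial>lborel)
        = (\<integral>\<^sup>+y. indicator B x * indicator A (x + y) \<partial>lborel)"
      by (subst lborel_distr_plus[of x, symmetric], subst nn_integral_distr) simp_all
  qed
  also have "\<dots> = (\<integral>\<^sup>+y. \<integral>\<^sup>+x. indicator B x * indicator A (x + y) \<partial>\<nu> \<partial>lborel)"
    by (rule Fubini'[symmetric]) simp
  also have "\<dots> = (\<integral>\<^sup>+y. \<integral>\<^sup>+x. indicator B (x - y) * indicator A x \<partial>\<nu> \<partial>lborel)"
  proof (rule nn_integral_cong)
    fix y :: 'a
    show "(\<integral>\<^sup>+x. indicator B x * indicator A (x + y) \<partial>\<nu>)
        = (\<integral>\<^sup>+x. indicator B (x - y) * indicator A x \<partial>\<nu>)"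
      by (subst (2) translation[of y, symmetric], subst nn_integral_distr)
         (simp_all add: add.commute)
  qed
  also have "\<dots> = (\<integral>\<^sup>+x. \<integral>\<^sup>+y. indicator B (y - x) * indicator A x \<partial>lborel \<partial>\<nu>)"
    by (subst Fubini') (simp_all add: B_diff)
  also have "\<dots> = (\<integral>\<^sup>+x. \<integral>\<^sup>+y. indicator B y * indicator A x \<partial>lborel \<partial>\<nu>)"
  proof (rule nn_integral_cong)
    fix x :: 'a
    show "(\<integral>\<^sup>+y. indicator B (y - x) * indicator A x \<partial>lborel)
        = (\<integral>\<^sup>+y. indicator B y * indicator A x \<partial>lborel)"
      by (subst lborel_distr_plus[of x, symmetric], subst nn_integral_distr) simp_all
  qed
  also have "\<dots> = emeasure lborel B * emeasure \<nu> A"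
    by (simp add: nn_integral_cmult nn_integral_multc sets)
  finally have "emeasure lborel B * emeasure lborel A = emeasure lborel B * emeasure \<nu> A"
    using ball by (simp add: B_def)
  moreover have "emeasure lborel B \<noteq> 0"
    using open_not_negligible[of B] by (auto simp: B_def negligible_iff_null_sets null_sets_completion_iff null_setsI)
  moreover have "emeasure lborel B \<noteq> \<infinity>"
    unfolding B_def using emeasure_lborel_ball_finite[of "0::'a" 1] by auto
  ultimately show "emeasure \<nu> A = emeasure lborel A"
    by (simp add: ennreal_mult_cancel_left)
qed

lemma borel_measurable_linear_map:
  fixes T :: "'a::euclidean_space \<Rightarrow> 'b::euclidean_space"
  assumes "linear T"
  shows "T \<in> borel_measurable borel"
  using assms by (intro borel_measurable_continuous_onI linear_continuous_on linear_conv_bounded_linear[THEN iffD1])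

lemma distr_lborel_orthogonal:
  fixes T :: "'a::euclidean_space \<Rightarrow> 'a"
  assumes T: "orthogonal_transformation T"
  shows "distr lborel borel T = lborel"
proof (rule lborel_eqI_translation_invariant)
  have lin: "linear T" using T by (rule orthogonal_transformation_linear)
  then have [measurable]: "T \<in> borel_measurable borel" by (rule borel_measurable_linear_map)
  obtain S where TS: "\<And>y. T (S y) = y"
    using T by (metis orthogonal_transformation_surj surj_f_inv_f)
  show "sets (distr lborel borel T) = sets borel" by simp
  have ball: "T -` ball 0 r = ball 0 r" for r
    using orthogonal_transformation_norm[OF T] by auto
  show "sigma_finite_measure (distr lborel borel T)"
  proof (intro sigma_finite_measure.intro exI conjI)
    show "countable (range (\<lambda>n. ball (0::'a) (real n)))" by simp
    show "range (\<lambda>n. ball (0::'a) (real n)) \<subseteq> sets (distr lborel borel T)" by auto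
    have "x \<in> \<Union>(range (\<lambda>n. ball (0::'a) (real n)))" for x
      using reals_Archimedean2[of "norm x"] by auto
    then show "\<Union>(range (\<lambda>n. ball (0::'a) (real n))) = space (distr lborel borel T)" by auto
    show "\<forall>a\<in>range (\<lambda>n. ball (0::'a) (real n)). emeasure (distr lborel borel T) a \<noteq> \<infinity>"
      using emeasure_lborel_ball_finite[of "0::'a"] by (auto simp: emeasure_distr ball less_top[symmetric])
  qed
  show "emeasure (distr lborel borel T) (ball 0 1) = emeasure lborel (ball (0::'a) 1)"
    by (simp add: emeasure_distr ball)
  fix y :: 'a
  have "distr (distr lborel borel T) borel ((+) y) = distr lborel borel (\<lambda>x. T (S y + x))"
    by (subst distr_distr) (simp_all add: o_def TS linear_add[OF lin])
  also have "\<dots> = distr (distr lborel borel ((+) (S y))) borel T"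
    by (subst distr_distr) (simp_all add: o_def)
  finally show "distr (distr lborel borel T) borel ((+) y) = distr lborel borel T"
    by (simp add: lborel_distr_plus)
qed

section \<open>The standard Gaussian measure\<close>

text \<open>The standard Gaussian law on a Euclidean space, as the product of one-dimensional densities in
  the coordinates of the orthonormal basis \<open>Basis\<close>.\<close>

definition std_gaussian :: "'a::euclidean_space measure" where
  "std_gaussian = density lborel (\<lambda>z. \<Prod>b\<in>Basis. std_normal_density (z \<bullet> b))"

lemma prod_std_normal_density:
  fixes z :: "'a::euclidean_space"
  shows "(\<Prod>b\<in>Basis. std_normal_density (z \<bullet> b))
    = (1 / sqrt (2 * pi)) ^ DIM('a) * exp (- (z \<bullet> z) / 2)"
proof -
  have "(\<Prod>b\<in>Basis. std_normal_density (z \<bullet> b))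
      = (1 / sqrt (2 * pi)) ^ DIM('a) * exp (\<Sum>b\<in>Basis. - (z \<bullet> b)\<^sup>2 / 2)"
    by (simp only: std_normal_density_def prod.distrib prod_constant exp_sum[OF finite_Basis])
  also have "(\<Sum>b\<in>Basis. - (z \<bullet> b)\<^sup>2 / 2) = - (z \<bullet> z) / 2"
    by (subst euclidean_inner)
       (simp add: power2_eq_square sum_negf sum_divide_distrib)
  finally show ?thesis .
qed

lemma distr_std_gaussian_orthogonal:
  fixes T :: "'a::euclidean_space \<Rightarrow> 'a"
  assumes T: "orthogonal_transformation T"
  shows "distr std_gaussian borel T = std_gaussian"
proof -
  have lin: "linear T" using T by (rule orthogonal_transformation_linear)
  then have [measurable]: "T \<in> borel_measurable borel" by (rule borel_measurable_linear_map)
  define \<rho> :: "'a \<Rightarrow> real" where "\<rho> z = (\<Prod>b\<in>Basis. std_normal_density (z \<bullet> b))" for z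
  have \<rho>: "\<rho> (T z) = \<rho> z" for z
    using T by (simp add: \<rho>_def prod_std_normal_density orthogonal_transformation_def)
  have [measurable]: "\<rho> \<in> borel_measurable borel" by (simp add: \<rho>_def[abs_def])
  have "distr (density lborel (\<lambda>z. ennreal (\<rho> (T z)))) borel T
      = density (distr lborel borel T) (\<lambda>z. ennreal (\<rho> z))"
    by (subst density_distr) simp_all
  then show ?thesis
    by (simp only: \<rho> distr_lborel_orthogonal[OF T] std_gaussian_def \<rho>_def[symmetric])
qed

lemma emeasure_std_gaussian_box:
  fixes l u :: "'a::euclidean_space"
  shows "emeasure std_gaussian (box l u)
    = (\<Prod>b\<in>Basis. emeasure (density lborel std_normal_density) {l \<bullet> b<..<u \<bullet> b})"
proof -
  have ind: "indicator (box l u) z = (\<Prod>b\<in>Basis. indicator {l \<bullet> b<..<u \<bullet> b} (z \<bullet> b) :: ennreal)" for z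
    by (cases "z \<in> box l u") (auto simp: box_def indicator_def prod_zero_iff intro!: prod.neutral[symmetric])
  have "emeasure std_gaussian (box l u)
      = (\<integral>\<^sup>+z. (\<Prod>b\<in>Basis. ennreal (std_normal_density (z \<bullet> b)) * indicator {l \<bullet> b<..<u \<bullet> b} (z \<bullet> b)) \<partial>lborel)"
    by (simp add: std_gaussian_def emeasure_density ind prod.distrib prod_ennreal)
  also have "\<dots> = (\<Prod>b\<in>Basis. \<integral>\<^sup>+t. ennreal (std_normal_density t) * indicator {l \<bullet> b<..<u \<bullet> b} t \<partial>lborel)"
    by (rule nn_integral_lborel_prod) auto
  finally show ?thesis by (simp add: emeasure_density)
qed

text \<open>A vector is standard Gaussian if its coordinates are distinct members of a finite i.i.d. standard
  normal family. The family may have members, those with index in \<open>I - K\<close>, that are not used; this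
  covers two columns of a Gaussian matrix as well as the whole matrix.\<close>

lemma distr_PiM_std_normal:
  fixes X :: "('i \<Rightarrow> real) \<Rightarrow> 'a::euclidean_space"
  assumes I: "finite I" and K: "K \<subseteq> I"
    and e: "bij_betw e K Basis"
    and X: "\<And>z i. i \<in> K \<Longrightarrow> X z \<bullet> e i = z i"
  shows "distr (\<Pi>\<^sub>M i\<in>I. density lborel std_normal_density) borel X = std_gaussian"
    (is "distr ?P borel X = _")
proof -
  let ?M = "density lborel (\<lambda>t. ennreal (std_normal_density t))"
  interpret M: prob_space ?M by (rule prob_space_normal_density) simp
  interpret product_prob_space "\<lambda>_. ?M" I by unfold_locales
  interpret P: prob_space ?P by (rule prob_space_PiM) unfold_locales
  have Basis: "Basis = e ` K" and inj: "inj_on e K"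
    using e by (auto simp: bij_betw_def)
  have [measurable]: "X \<in> borel_measurable ?P"
  proof (rule borel_measurable_euclidean_space[THEN iffD2], rule ballI)
    fix b :: 'a assume "b \<in> Basis"
    then obtain i where i: "i \<in> K" "b = e i" by (auto simp: Basis)
    then have "(\<lambda>z. z i) \<in> ?P \<rightarrow>\<^sub>M ?M"
      using K by (intro measurable_component_singleton) auto
    then show "(\<lambda>z. X z \<bullet> b) \<in> borel_measurable ?P"
      using i by (simp add: X cong: measurable_cong_sets)
  qed
  show "distr ?P borel X = std_gaussian"
  proof (rule measure_eqI_generator_eq)
    let ?E = "range (\<lambda>(a, b). box a b :: 'a set)"
    show "Int_stable ?E" by (auto simp: Int_stable_def box_Int_box)
    show "?E \<subseteq> Pow UNIV" "sets (distr ?P borel X) = sigma_sets UNIV ?E"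
      "sets (std_gaussian :: 'a measure) = sigma_sets UNIV ?E"
      by (simp_all add: borel_eq_box std_gaussian_def)
    let ?A = "\<lambda>n::nat. box (- (real n *\<^sub>R One)) (real n *\<^sub>R One) :: 'a set"
    show "range ?A \<subseteq> ?E" "(\<Union>i. ?A i) = UNIV"
      unfolding UN_box_eq_UNIV by auto
    show "emeasure (distr ?P borel X) (?A i) \<noteq> \<infinity>" for i
      by (simp add: emeasure_distr P.emeasure_eq_measure)
    fix B assume "B \<in> ?E"
    then obtain l u where B: "B = box l u" by auto
    define J where "J i = (if i \<in> K then {l \<bullet> e i<..<u \<bullet> e i} else UNIV)" for i
    have "X -` B \<inter> space ?P = (\<Pi>\<^sub>E i\<in>I. J i)"
      using subsetD[OF K] by (auto simp: B mem_box Basis X J_def space_PiM PiE_def Pi_def)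
    then have "emeasure (distr ?P borel X) B = emeasure ?P (\<Pi>\<^sub>E i\<in>I. J i)"
      by (simp add: emeasure_distr B)
    also have "\<dots> = (\<Prod>i\<in>I. emeasure ?M (J i))"
      using I by (intro emeasure_PiM) (auto simp: J_def)
    also have "\<dots> = (\<Prod>i\<in>K. emeasure ?M (J i))"
      using I K M.emeasure_space_1 by (intro prod.mono_neutral_right) (auto simp: J_def)
    also have "\<dots> = emeasure std_gaussian B"
      by (simp add: B emeasure_std_gaussian_box Basis prod.reindex[OF inj] J_def)
    finally show "emeasure (distr ?P borel X) B = emeasure std_gaussian B" .
  qed
qed

lemma gaussian_matrix_eq_std_gaussian:
  "(gaussian_matrix :: (real ^ 'd ^ 'm) measure) = std_gaussian"
  unfolding gaussian_matrix_def
proof (rule distr_PiM_std_normal)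
  show "bij_betw (\<lambda>(i, j). axis i (axis j 1) :: real ^ 'd ^ 'm) UNIV Basis"
    by (auto simp: bij_betw_def inj_on_def axis_eq_axis Basis_vec_def)
  show "(\<chi> i j. z (i, j)) \<bullet> ((\<lambda>(i, j). axis i (axis j 1) :: real ^ 'd ^ 'm) p) = z p" for z p
    by (cases p) (simp add: inner_axis)
qed auto

lemma distr_gaussian_matrix_columns:
  assumes "k \<noteq> k'"
  shows "distr (gaussian_matrix :: (real ^ 'd ^ 'm) measure) borel (\<lambda>Z. (column k Z, column k' Z)) = std_gaussian"
proof -
  let ?P = "\<Pi>\<^sub>M p\<in>(UNIV :: ('m \<times> 'd) set). density lborel (\<lambda>t. ennreal (std_normal_density t))"
  have "(\<lambda>Z :: real ^ 'd ^ 'm. (column k Z, column k' Z)) \<in> borel_measurable borel"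
    unfolding column_def by (intro borel_measurable_continuous_onI continuous_intros)
  then have "distr (gaussian_matrix :: (real ^ 'd ^ 'm) measure) borel (\<lambda>Z. (column k Z, column k' Z))
      = distr ?P borel (\<lambda>z. (\<chi> i. z (i, k), \<chi> i. z (i, k')))"
    unfolding gaussian_matrix_def
    by (subst distr_distr[OF _ measurable_entries_to_matrix]) (simp_all add: o_def column_def)
  also have "\<dots> = std_gaussian"
  proof (rule distr_PiM_std_normal)
    let ?e = "\<lambda>(i, j). if j = k then (axis i 1, 0) else (0, axis i 1) :: (real ^ 'm) \<times> (real ^ 'm)"
    have "Basis = ?e ` (UNIV \<times> {k, k'})"
      using assms by (auto simp: Basis_prod_def Basis_vec_def image_iff)
    then show "bij_betw ?e (UNIV \<times> {k, k'}) Basis"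
      using assms by (auto simp: bij_betw_def inj_on_def axis_eq_axis split: if_splits)
    show "(\<chi> i. z (i, k), \<chi> i. z (i, k')) \<bullet> ?e p = z p" if "p \<in> UNIV \<times> {k, k'}" for z p
      using that assms by (auto simp: inner_axis)
  qed auto
  finally show ?thesis .
qed

section \<open>Reflection invariance of the Gaussian matrix\<close>

text \<open>The reflection in the hyperplane orthogonal to \<open>v\<close>. Division by zero makes it the identity for
  \<open>v = 0\<close>, so that for \<open>a\<close> and \<open>b\<close> of the same norm \<open>reflect (a - b)\<close> exchanges \<open>a\<close> and \<open>b\<close> even
  when they are equal.\<close>

definition reflect :: "'a::real_inner \<Rightarrow> 'a \<Rightarrow> 'a" where
  "reflect v y = y - (2 * (y \<bullet> v) / (v \<bullet> v)) *\<^sub>R v"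

lemma linear_reflect: "linear (reflect v)"
  by (rule linearI) (simp_all add: reflect_def algebra_simps inner_add_left add_divide_distrib)

lemma reflect_orthogonal: "y \<bullet> v = 0 \<Longrightarrow> reflect v y = y"
  by (simp add: reflect_def)

lemma reflect_self: "reflect v v = - v"
  by (cases "v = 0") (simp_all add: reflect_def scaleR_2)

lemma reflect_adjoint: "reflect v y \<bullet> z = y \<bullet> reflect v z"
  by (simp add: reflect_def inner_diff_left inner_diff_right inner_commute)

lemma reflect_reflect: "reflect v (reflect v y) = y"
proof (cases "v = 0")
  case False
  then have "reflect v y \<bullet> v = - (y \<bullet> v)"
    by (simp add: reflect_def inner_diff_left)
  then show ?thesis by (simp add: reflect_def[of v "reflect v y"]) (simp add: reflect_def)
qed (simp add: reflect_def)

lemma reflect_inner: "reflect v y \<bullet> reflect v z = y \<bullet> z"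
  by (simp add: reflect_adjoint reflect_reflect)

lemma reflect_swap:
  assumes "norm a = norm b"
  shows "reflect (a - b) a = b"
proof (cases "a = b")
  case False
  have "a \<bullet> a = b \<bullet> b" using assms by (simp add: norm_eq_sqrt_inner)
  then have "(a - b) \<bullet> (a - b) = 2 * (a \<bullet> (a - b))"
    by (simp add: inner_diff_left inner_diff_right inner_commute)
  moreover have "(a - b) \<bullet> (a - b) \<noteq> 0" using False by simp
  ultimately show ?thesis by (simp add: reflect_def)
qed (simp add: reflect_def)

text \<open>Right multiplication of \<open>Z\<close> by the symmetric matrix of the reflection, written row by row.\<close>

definition reflect_rows :: "real ^ 'd \<Rightarrow> real ^ 'd ^ 'm \<Rightarrow> real ^ 'd ^ 'm" where
  "reflect_rows v Z = (\<chi> i. reflect v (Z $ i))"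

lemma reflect_rows_mult: "reflect_rows v Z *v y = Z *v reflect v y"
  by (simp add: vec_eq_iff reflect_rows_def matrix_mult_dot row_def reflect_adjoint)

lemma orthogonal_transformation_reflect_rows: "orthogonal_transformation (reflect_rows v)"
  unfolding orthogonal_transformation_def
proof (intro conjI allI)
  show "linear (reflect_rows v)"
    using linear_reflect[of v]
    by (intro linearI) (simp_all add: vec_eq_iff reflect_rows_def linear_add linear_scale)
  show "reflect_rows v Z \<bullet> reflect_rows v W = Z \<bullet> W" for Z W
    unfolding inner_vec_def[of "reflect_rows v Z"] inner_vec_def[of Z]
    by (simp add: reflect_rows_def reflect_inner)
qed

lemma measurable_reflect_rows [measurable]: "reflect_rows v \<in> borel_measurable borel"
  using orthogonal_transformation_reflect_rows[of v, THEN orthogonal_transformation_linear]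
  by (rule borel_measurable_linear_map)

lemma distr_gaussian_matrix_reflect_rows:
  "distr gaussian_matrix borel (reflect_rows v) = gaussian_matrix"
  unfolding gaussian_matrix_eq_std_gaussian
  by (rule distr_std_gaussian_orthogonal[OF orthogonal_transformation_reflect_rows])

lemma measurable_matrix_vector_mult [measurable]:
  "(\<lambda>Z :: real ^ 'd ^ 'm. Z *v y) \<in> borel_measurable borel"
  unfolding matrix_vector_mult_def
  by (intro borel_measurable_continuous_onI continuous_intros)

lemma sets_gaussian_matrix [measurable_cong, simp]: "sets gaussian_matrix = sets borel"
  by (simp add: gaussian_matrix_def)

lemma distr_gaussian_matrix_reflect_pair:
  fixes y z :: "real ^ 'd"
  shows "distr (gaussian_matrix :: (real ^ 'd ^ 'm) measure) borel (\<lambda>Z. (Z *v reflect v y, Z *v reflect v z))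
    = distr gaussian_matrix borel (\<lambda>Z. (Z *v y, Z *v z))"
  by (subst (2) distr_gaussian_matrix_reflect_rows[of v, symmetric], subst distr_distr)
     (simp_all add: o_def reflect_rows_mult)

text \<open>The images of two orthonormal vectors under \<open>Z\<close> are independent standard Gaussian vectors: two
  reflections carry \<open>x, e\<close> to two coordinate axes without changing the law, and the images of
  coordinate axes are columns of \<open>Z\<close>.\<close>

lemma distr_gaussian_matrix_orthonormal:
  fixes x e :: "real ^ 'd"
  assumes "norm x = 1" "norm e = 1" "x \<bullet> e = 0"
  shows "distr (gaussian_matrix :: (real ^ 'd ^ 'm) measure) borel (\<lambda>Z. (Z *v x, Z *v e)) = std_gaussian"
proof -
  \<comment> \<open>In dimension one, nonzero vectors cannot be orthogonal.\<close>
  obtain k k' :: 'd where k: "k \<noteq> k'"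
  proof (rule ccontr)
    assume "\<not> thesis"
    then have "\<And>j j' :: 'd. j = j'" using that by blast
    then have UNIV: "UNIV = {undefined :: 'd}" by blast
    have "sum f (UNIV :: 'd set) = f undefined" for f :: "'d \<Rightarrow> real"
      unfolding UNIV by simp
    then have "norm x * norm e = \<bar>x \<bullet> e\<bar>"
      by (simp add: norm_eq_sqrt_inner inner_vec_def abs_mult)
    then show False using assms by simp
  qed
  define a :: "real ^ 'd" where "a = axis k 1"
  define a' :: "real ^ 'd" where "a' = axis k' 1"
  have a: "norm a = 1" "norm a' = 1" "a \<bullet> a' = 0"
    using k by (simp_all add: a_def a'_def inner_axis_axis)
  \<comment> \<open>The first reflection sends \<open>x\<close> to \<open>a\<close>. The second sends the image of \<open>e\<close> to \<open>a'\<close> and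
    fixes \<open>a\<close>, which is orthogonal to both.\<close>
  define e' where "e' = reflect (x - a) e"
  have x: "reflect (x - a) x = a" using assms a by (intro reflect_swap) simp
  have "a \<bullet> e' = 0"
    using assms(3) reflect_inner[of "x - a" x e] by (simp add: x e'_def)
  moreover have "norm e' = 1"
    using assms(2) by (simp add: e'_def norm_eq_sqrt_inner reflect_inner)
  ultimately have "reflect (e' - a') e' = a'" "reflect (e' - a') a = a"
    using a by (auto intro!: reflect_swap reflect_orthogonal simp: inner_diff_right)
  note e' = this
  have "distr (gaussian_matrix :: (real ^ 'd ^ 'm) measure) borel (\<lambda>Z. (Z *v x, Z *v e))
      = distr gaussian_matrix borel (\<lambda>Z. (Z *v a, Z *v e'))"
    using distr_gaussian_matrix_reflect_pair[of "x - a" x e, symmetric]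
    unfolding x e'_def[symmetric] .
  also have "\<dots> = distr gaussian_matrix borel (\<lambda>Z. (Z *v a, Z *v a'))"
    using distr_gaussian_matrix_reflect_pair[of "e' - a'" a e', symmetric]
    unfolding e' .
  also have "\<dots> = std_gaussian"
    using distr_gaussian_matrix_columns[OF k] by (simp add: a_def a'_def matrix_vector_mult_basis)
  finally show ?thesis .
qed

section \<open>The joint law of the two images\<close>

lemma joint_density_eq:
  fixes x xs :: "real ^ 'd" and u w :: "real ^ 'm"
  defines "c \<equiv> x \<bullet> xs"
  shows "joint_density x xs (u, w)
    = (1 / (2 * pi * sqrt (1 - c\<^sup>2))) ^ CARD('m)
      * exp (- (u \<bullet> u - 2 * c * (u \<bullet> w) + w \<bullet> w) / (2 * (1 - c\<^sup>2)))"
proof -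
  have "(\<Sum>i\<in>UNIV. - ((u $ i)\<^sup>2 - 2 * c * (u $ i) * (w $ i) + (w $ i)\<^sup>2) / (2 * (1 - c\<^sup>2)))
      = - (u \<bullet> u - 2 * c * (u \<bullet> w) + w \<bullet> w) / (2 * (1 - c\<^sup>2))"
    by (simp only: inner_vec_def inner_real_def sum_divide_distrib[symmetric] sum_negf
        sum.distrib sum_subtractf sum_distrib_left power2_eq_square mult.assoc)
  moreover have "joint_density x xs (u, w) = (1 / (2 * pi * sqrt (1 - c\<^sup>2))) ^ CARD('m)
    * exp (\<Sum>i\<in>UNIV. - ((u $ i)\<^sup>2 - 2 * c * (u $ i) * (w $ i) + (w $ i)\<^sup>2) / (2 * (1 - c\<^sup>2)))"
    by (simp add: joint_density_def c_def[symmetric] Let_def exp_sum prod_dividef power_divide)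
  ultimately show ?thesis by simp
qed

lemma joint_density_nonneg: "0 \<le> joint_density x xs p" if "(x \<bullet> xs)\<^sup>2 \<le> 1"
  using that by (cases p) (simp add: joint_density_eq)

lemma measurable_joint_density [measurable]:
  "(joint_density x xs :: (real ^ 'm) \<times> (real ^ 'm) \<Rightarrow> real) \<in> borel_measurable borel"
proof -
  have "(joint_density x xs :: (real ^ 'm) \<times> (real ^ 'm) \<Rightarrow> real)
      = (\<lambda>p. (1 / (2 * pi * sqrt (1 - (x \<bullet> xs)\<^sup>2))) ^ CARD('m)
      * exp (- (fst p \<bullet> fst p - 2 * (x \<bullet> xs) * (fst p \<bullet> snd p) + snd p \<bullet> snd p) * (1 / (2 * (1 - (x \<bullet> xs)\<^sup>2)))))"
    by (auto simp: joint_density_eq fun_eq_iff)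
  also have "\<dots> \<in> borel_measurable borel"
    by (intro borel_measurable_continuous_onI continuous_intros)
  finally show ?thesis .
qed

lemma nn_integral_lborel_affine:
  fixes f :: "'a::euclidean_space \<Rightarrow> ennreal"
  assumes [measurable]: "f \<in> borel_measurable borel" and s: "s \<noteq> 0"
  shows "(\<integral>\<^sup>+w. f w \<partial>lborel) = (\<integral>\<^sup>+v. \<bar>s\<bar> ^ DIM('a) * f (t + s *\<^sub>R v) \<partial>lborel)"
  by (subst lborel_affine[OF s, of t])
     (simp add: nn_integral_density nn_integral_distr ennreal_power)

lemma nn_integral_lborel_pair:
  fixes f :: "'a::euclidean_space \<times> 'b::euclidean_space \<Rightarrow> ennreal"
  assumes "f \<in> borel_measurable borel"
  shows "(\<integral>\<^sup>+z. f z \<partial>lborel) = (\<integral>\<^sup>+u. \<integral>\<^sup>+w. f (u, w) \<partial>lborel \<partial>lborel)"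
proof -
  have "f \<in> borel_measurable (lborel \<Otimes>\<^sub>M lborel)" using assms by (simp add: lborel_prod)
  then show ?thesis by (simp add: lborel.nn_integral_fst lborel_prod)
qed

text \<open>With \<open>xs = c x + s e\<close>, where \<open>e\<close> is a unit vector orthogonal to \<open>x\<close>, the pair \<open>(Z x, Z xs)\<close> is
  the image of a standard Gaussian pair \<open>(u, v)\<close> under \<open>(u, v) \<mapsto> (u, c u + s v)\<close>. The
  substitution \<open>w = c u + s v\<close> at fixed \<open>u\<close> turns the standard density into \<open>joint_density\<close>.\<close>

lemma distr_gaussian_matrix_joint_density:
  fixes x xs :: "real ^ 'd"
  assumes x: "norm x = 1" and xs: "norm xs = 1" and c: "\<bar>x \<bullet> xs\<bar> < 1"
  shows "distr (gaussian_matrix :: (real ^ 'd ^ 'm) measure) borel (\<lambda>Z. (Z *v x, Z *v xs))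
    = density lborel (joint_density x xs)"
proof -
  define c where "c = x \<bullet> xs"
  define s where "s = sqrt (1 - c\<^sup>2)"
  have c1: "c\<^sup>2 < 1" using \<open>\<bar>x \<bullet> xs\<bar> < 1\<close> by (simp add: c_def abs_square_less_1)
  then have s: "s > 0" "s\<^sup>2 = 1 - c\<^sup>2" by (simp_all add: s_def)
  define e where "e = (1 / s) *\<^sub>R (xs - c *\<^sub>R x)"
  have xs_e: "xs = c *\<^sub>R x + s *\<^sub>R e" using s by (simp add: e_def)
  have xx: "x \<bullet> x = 1" "xs \<bullet> xs = 1" using x xs by (simp_all add: norm_eq_1)
  have "x \<bullet> e = 0" by (simp add: e_def inner_diff_right xx c_def)
  moreover have "norm e = 1"
  proof -
    have "(xs - c *\<^sub>R x) \<bullet> (xs - c *\<^sub>R x) = s\<^sup>2"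
      unfolding s(2)
      by (simp add: inner_diff_left inner_diff_right xx c_def[symmetric] inner_commute[of xs x] power2_eq_square)
    then have "e \<bullet> e = 1" using s(1) by (simp add: e_def power2_eq_square)
    then show ?thesis by (simp add: norm_eq_1)
  qed
  ultimately have law: "distr (gaussian_matrix :: (real ^ 'd ^ 'm) measure) borel (\<lambda>Z. (Z *v x, Z *v e)) = std_gaussian"
    using x by (intro distr_gaussian_matrix_orthonormal)
  define S :: "(real ^ 'm) \<times> (real ^ 'm) \<Rightarrow> _" where "S = (\<lambda>(u, v). (u, c *\<^sub>R u + s *\<^sub>R v))"
  have [measurable]: "S \<in> borel_measurable borel"
    unfolding S_def case_prod_beta
    by (intro borel_measurable_continuous_onI continuous_intros)
  have "distr (gaussian_matrix :: (real ^ 'd ^ 'm) measure) borel (\<lambda>Z. (Z *v x, Z *v xs)) = distr std_gaussian borel S"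
  proof -
    have "S \<circ> (\<lambda>Z. (Z *v x, Z *v e)) = (\<lambda>Z. (Z *v x, Z *v xs))"
      by (simp add: fun_eq_iff S_def xs_e matrix_vector_right_distrib matrix_vector_mult_scaleR)
    then show ?thesis unfolding law[symmetric] by (subst distr_distr) simp_all
  qed
  also have "\<dots> = density lborel (joint_density x xs)"
  proof (rule measure_eqI)
    fix A assume "A \<in> sets (distr std_gaussian borel S)"
    then have [measurable]: "A \<in> sets borel" by simp
    define \<rho> :: "(real ^ 'm) \<times> (real ^ 'm) \<Rightarrow> real" where "\<rho> z = (\<Prod>b\<in>Basis. std_normal_density (z \<bullet> b))" for z
    have [measurable]: "\<rho> \<in> borel_measurable borel" by (simp add: \<rho>_def[abs_def])
    have \<rho>_nonneg: "0 \<le> \<rho> z" for z by (simp add: \<rho>_def prod_nonneg)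
    have dens: "s ^ CARD('m) * joint_density x xs (u, c *\<^sub>R u + s *\<^sub>R v) = \<rho> (u, v)" for u v
    proof -
      let ?w = "c *\<^sub>R u + s *\<^sub>R v"
      have "u \<bullet> u - 2 * c * (u \<bullet> ?w) + ?w \<bullet> ?w = (1 - c\<^sup>2) * (u \<bullet> u) + s\<^sup>2 * (v \<bullet> v)"
        by (simp add: inner_add_left inner_add_right inner_commute power2_eq_square algebra_simps)
      then have "- (u \<bullet> u - 2 * c * (u \<bullet> ?w) + ?w \<bullet> ?w) / (2 * (1 - c\<^sup>2)) = - (u \<bullet> u + v \<bullet> v) / 2"
        using s c1 by (simp add: field_simps)
      moreover have "s * (1 / (2 * pi * s)) = (1 / sqrt (2 * pi))\<^sup>2"
        using s by (simp add: power_divide)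
      then have "s ^ CARD('m) * (1 / (2 * pi * s)) ^ CARD('m) = (1 / sqrt (2 * pi)) ^ (CARD('m) + CARD('m))"
        by (simp only: power_mult_distrib[symmetric] power_mult[symmetric] mult_2[symmetric])
      ultimately show ?thesis
        by (simp only: joint_density_eq c_def[symmetric] s_def[symmetric] \<rho>_def prod_std_normal_density mult.assoc[symmetric])
           simp
    qed
    have "emeasure (density lborel (joint_density x xs)) A
        = (\<integral>\<^sup>+z. ennreal (joint_density x xs z) * indicator A z \<partial>lborel)"
      by (simp add: emeasure_density)
    also have "\<dots> = (\<integral>\<^sup>+u. \<integral>\<^sup>+w. ennreal (joint_density x xs (u, w)) * indicator A (u, w) \<partial>lborel \<partial>lborel)"
      by (rule nn_integral_lborel_pair) simp
    also have "\<dots> = (\<integral>\<^sup>+u. \<integral>\<^sup>+v. ennreal (\<rho> (u, v)) * indicator A (S (u, v)) \<partial>lborel \<partial>lborel)"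
    proof (rule nn_integral_cong)
      fix u :: "real ^ 'm"
      show "(\<integral>\<^sup>+w. ennreal (joint_density x xs (u, w)) * indicator A (u, w) \<partial>lborel)
          = (\<integral>\<^sup>+v. ennreal (\<rho> (u, v)) * indicator A (S (u, v)) \<partial>lborel)"
        using s(1)
        by (subst nn_integral_lborel_affine[where s=s and t="c *\<^sub>R u"])
           (simp_all add: S_def dens[symmetric] ennreal_mult' mult.assoc ennreal_power[symmetric])
    qed
    also have "\<dots> = (\<integral>\<^sup>+z. ennreal (\<rho> z) * indicator A (S z) \<partial>lborel)"
      by (rule nn_integral_lborel_pair[symmetric]) simp
    also have "\<dots> = (\<integral>\<^sup>+z. indicator A (S z) \<partial>std_gaussian)"
      by (simp add: std_gaussian_def nn_integral_density \<rho>_def[symmetric])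
    also have "\<dots> = (\<integral>\<^sup>+z. indicator A z \<partial>distr std_gaussian borel S)"
      by (subst nn_integral_distr) (simp_all add: std_gaussian_def)
    also have "\<dots> = emeasure (distr std_gaussian borel S) A" by simp
    finally show "emeasure (distr std_gaussian borel S) A = emeasure (density lborel (joint_density x xs)) A" ..
  qed (simp add: std_gaussian_def)
  finally show ?thesis .
qed

text \<open>The score identity: the logarithmic derivative of the joint density in \<open>w\<close> is, up to the factor
  \<open>-1 / (1 - c\<^sup>2)\<close>, the component \<open>w - c u\<close> of \<open>w\<close> that is independent of \<open>u\<close>.\<close>

lemma partial_w_joint_density:
  fixes x xs :: "real ^ 'd" and u w :: "real ^ 'm"
  assumes "\<bar>x \<bullet> xs\<bar> < 1"
  shows "partial_w i (joint_density x xs) (u, w)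
    = - (w $ i - (x \<bullet> xs) * u $ i) / (1 - (x \<bullet> xs)\<^sup>2) * joint_density x xs (u, w)"
proof -
  define c where "c = x \<bullet> xs"
  have "1 - c\<^sup>2 \<noteq> 0" using assms by (simp add: c_def abs_square_eq_1)
  have eq: "joint_density x xs (u, w + t *\<^sub>R axis i 1)
    = (1 / (2 * pi * sqrt (1 - c\<^sup>2))) ^ CARD('m)
      * exp (- (u \<bullet> u - 2 * c * (u \<bullet> w + t * u $ i) + (w \<bullet> w + 2 * t * w $ i + t\<^sup>2)) / (2 * (1 - c\<^sup>2)))" for t
    by (simp add: joint_density_eq c_def[symmetric] inner_add_left inner_add_right inner_axis
        inner_commute[of "axis i 1"] power2_eq_square algebra_simps)
  have "((\<lambda>t. joint_density x xs (u, w + t *\<^sub>R axis i 1)) has_real_derivative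
      - (w $ i - c * u $ i) / (1 - c\<^sup>2) * joint_density x xs (u, w)) (at 0)"
    unfolding eq
    using \<open>1 - c\<^sup>2 \<noteq> 0\<close>
    by (auto intro!: derivative_eq_intros simp: joint_density_eq c_def[symmetric] divide_simps)
       (simp add: algebra_simps)
  then show ?thesis by (simp add: partial_w_def DERIV_imp_deriv c_def)
qed

section \<open>The direction of the expected gradient\<close>

lemma tangent_proj_mult:
  "tangent_proj x *v y = y - (x \<bullet> y) *\<^sub>R x"
proof -
  have "(\<chi> i j. x $ i * x $ j) *v y = (x \<bullet> y) *\<^sub>R x"
    by (simp add: vec_eq_iff matrix_vector_mult_def inner_vec_def sum_distrib_left mult_ac)
  then show ?thesis
    by (simp add: tangent_proj_def matrix_vector_mult_diff_rdistrib)
qed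

lemma g_integrand_inner:
  "g_integrand dl x xs Z \<bullet> a = dl (Z *v x) (Z *v xs) x xs \<bullet> (Z *v (a - (x \<bullet> a) *\<^sub>R x))"
proof -
  let ?G = "dl (Z *v x) (Z *v xs) x xs"
  have "g_integrand dl x xs Z \<bullet> a = (transpose Z *v ?G) \<bullet> (a - (x \<bullet> a) *\<^sub>R x)"
    by (simp add: g_integrand_def tangent_proj_mult inner_diff_left inner_diff_right inner_commute)
  also have "\<dots> = ?G \<bullet> (Z *v (a - (x \<bullet> a) *\<^sub>R x))"
    using dot_lmul_matrix[of ?G Z "a - (x \<bullet> a) *\<^sub>R x"] by simp
  finally show ?thesis .
qed

lemma g_loss_inner:
  fixes dl :: "real ^ 'm \<Rightarrow> real ^ 'm \<Rightarrow> real ^ 'd \<Rightarrow> real ^ 'd \<Rightarrow> real ^ 'm"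
  assumes "integrable gaussian_matrix (g_integrand dl x xs)"
  shows "g_loss dl x xs \<bullet> a
    = (\<integral>Z. dl (Z *v x) (Z *v xs) x xs \<bullet> (Z *v (a - (x \<bullet> a) *\<^sub>R x)) \<partial>gaussian_matrix)"
  using integral_inner_left[of a gaussian_matrix "g_integrand dl x xs"] assms
  by (simp add: g_loss_def g_integrand_inner)

lemma g_loss_orthogonal_base:
  assumes "integrable gaussian_matrix (g_integrand dl x xs)" "norm x = 1"
  shows "g_loss dl x xs \<bullet> x = 0"
  using assms(2) by (simp add: g_loss_inner[OF assms(1)] norm_eq_1 matrix_vector_mult_0_right)

text \<open>Reflecting \<open>Z\<close> along \<open>f\<close> fixes \<open>Z x\<close> and \<open>Z xs\<close>, hence the gradient of the loss, and changes the
  sign of \<open>Z f\<close>. The integrand is therefore odd under a symmetry of the law of \<open>Z\<close>.\<close>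

lemma g_loss_orthogonal_complement:
  fixes dl :: "real ^ 'm \<Rightarrow> real ^ 'm \<Rightarrow> real ^ 'd \<Rightarrow> real ^ 'd \<Rightarrow> real ^ 'm"
  assumes int: "integrable gaussian_matrix (g_integrand dl x xs)"
    and dl: "(\<lambda>(u, w). dl u w x xs) \<in> borel_measurable borel"
    and f: "f \<bullet> x = 0" "f \<bullet> xs = 0"
  shows "g_loss dl x xs \<bullet> f = 0"
proof -
  define F :: "real ^ 'd ^ 'm \<Rightarrow> real" where "F Z = dl (Z *v x) (Z *v xs) x xs \<bullet> (Z *v f)" for Z
  have "(\<lambda>Z :: real ^ 'd ^ 'm. (Z *v x, Z *v xs)) \<in> borel_measurable borel" by measurable
  from measurable_compose[OF this dl] have [measurable]: "F \<in> borel_measurable borel"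
    unfolding F_def by simp
  have neg: "Z *v (- f) = - (Z *v f)" for Z :: "real ^ 'd ^ 'm"
    using matrix_vector_mult_diff_distrib[of Z 0 f] by simp
  have "F (reflect_rows f Z) = - F Z" for Z
    using f by (simp add: F_def reflect_rows_mult reflect_orthogonal inner_commute reflect_self neg)
  then have "(\<integral>Z. F Z \<partial>gaussian_matrix) = (\<integral>Z. - F Z \<partial>gaussian_matrix)"
    by (subst distr_gaussian_matrix_reflect_rows[of f, symmetric], subst integral_distr) simp_all
  then show ?thesis
    using f by (simp add: g_loss_inner[OF int] F_def inner_commute[of x f])
qed

text \<open>The component along \<open>xs\<close> is the expectation of \<open>G(u, w) \<bullet> (w - c u)\<close> over the joint law of
  \<open>(u, w) = (Z x, Z xs)\<close>, with \<open>G\<close> the gradient of the loss. By the score identity it is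
  \<open>1 - c\<^sup>2\<close> times the sum of the pairings that define the expected trace.\<close>

lemma g_loss_inner_eq_trace:
  fixes dl :: "real ^ 'm \<Rightarrow> real ^ 'm \<Rightarrow> real ^ 'd \<Rightarrow> real ^ 'd \<Rightarrow> real ^ 'm"
  assumes int: "integrable gaussian_matrix (g_integrand dl x xs)"
    and dl: "(\<lambda>(u, w). dl u w x xs) \<in> borel_measurable borel"
    and int_D2: "\<And>i. integrable lborel
      (\<lambda>(u, w). dl u w x xs $ i * partial_w i (joint_density x xs) (u, w))"
    and x: "norm x = 1" and xs: "norm xs = 1" and c: "\<bar>x \<bullet> xs\<bar> < 1"
  shows "g_loss dl x xs \<bullet> xs
    = (1 - (x \<bullet> xs)\<^sup>2) * expected_trace_D2 (\<lambda>u w. dl u w x xs) x xs"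
proof -
  define c where "c = x \<bullet> xs"
  have c1: "c\<^sup>2 < 1" using \<open>\<bar>x \<bullet> xs\<bar> < 1\<close> by (simp add: c_def abs_square_less_1)
  define F :: "(real ^ 'm) \<times> (real ^ 'm) \<Rightarrow> real"
    where "F = (\<lambda>(u, w). dl u w x xs \<bullet> (w - c *\<^sub>R u))"
  note dl [measurable]
  have [measurable]: "F \<in> borel_measurable borel"
  proof -
    have "F = (\<lambda>p. (case p of (u, w) \<Rightarrow> dl u w x xs) \<bullet> (snd p - c *\<^sub>R fst p))"
      by (auto simp: F_def)
    moreover have "(\<lambda>p :: (real ^ 'm) \<times> (real ^ 'm). snd p - c *\<^sub>R fst p) \<in> borel_measurable borel"
      by (intro borel_measurable_continuous_onI continuous_intros)
    ultimately show ?thesis using dl by simp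
  qed
  have "g_loss dl x xs \<bullet> xs = (\<integral>Z. F (Z *v x, Z *v xs) \<partial>gaussian_matrix)"
    by (simp add: g_loss_inner[OF int] F_def c_def matrix_vector_mult_diff_distrib matrix_vector_mult_scaleR)
  also have "\<dots> = (\<integral>p. F p \<partial>distr gaussian_matrix borel (\<lambda>Z. (Z *v x, Z *v xs)))"
    by (subst integral_distr) simp_all
  also have "\<dots> = (\<integral>p. joint_density x xs p * F p \<partial>lborel)"
    using c1 by (simp add: distr_gaussian_matrix_joint_density[OF x xs c] integral_density
        joint_density_nonneg c_def)
  also have "\<dots> = (\<integral>p. (1 - c\<^sup>2) * (\<Sum>i\<in>UNIV.
      - (case p of (u, w) \<Rightarrow> dl u w x xs $ i * partial_w i (joint_density x xs) (u, w))) \<partial>lborel)"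
  proof (rule Bochner_Integration.integral_cong)
    fix p :: "(real ^ 'm) \<times> (real ^ 'm)"
    obtain u w where p: "p = (u, w)" by fastforce
    have "(1 - c\<^sup>2) * (- (dl u w x xs $ i * partial_w i (joint_density x xs) (u, w)))
        = joint_density x xs (u, w) * (dl u w x xs $ i * (w $ i - c * u $ i))" for i
      using c1 by (simp add: partial_w_joint_density[OF c] c_def[symmetric] divide_simps) (simp add: algebra_simps)
    then show "joint_density x xs p * F p = (1 - c\<^sup>2) * (\<Sum>i\<in>UNIV.
        - (case p of (u, w) \<Rightarrow> dl u w x xs $ i * partial_w i (joint_density x xs) (u, w)))"
      unfolding p prod.case sum_distrib_left
      by (simp add: F_def inner_vec_def sum_distrib_left)
  qed simp
  also have "\<dots> = (1 - c\<^sup>2) * expected_trace_D2 (\<lambda>u w. dl u w x xs) x xs"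
    using int_D2 by (simp add: expected_trace_D2_def trace_def weak_D2_def)
  finally show ?thesis by (simp add: c_def)
qed

theorem theorem4p16:
  fixes l :: "real ^ 'm \<Rightarrow> real ^ 'm \<Rightarrow> real ^ 'd \<Rightarrow> real ^ 'd \<Rightarrow> real"
    and dl :: "real ^ 'm \<Rightarrow> real ^ 'm \<Rightarrow> real ^ 'd \<Rightarrow> real ^ 'd \<Rightarrow> real ^ 'm"
    and x xs :: "real ^ 'd"
  assumes xs: "xs \<in> sphere 0 1"
    and lipschitz: "\<And>w y ys. local_lipschitz {w} UNIV (\<lambda>w u. l u w y ys)"
    and selection: "partial1_selection l dl"
    and x: "x \<in> sphere 0 1"
    and angle: "0 < angle x xs" "angle x xs < pi / 2"
    and integrable_dl: "integrable gaussian_matrix (\<lambda>Z. dl (Z *v x) (Z *v xs) x xs)"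
    and integrable_g: "integrable gaussian_matrix (g_integrand dl x xs)"
    and integrable_D2: "\<And>i. integrable lborel
      (\<lambda>(u, w). dl u w x xs $ i * partial_w i (joint_density x xs) (u, w))"
    and trace_neg: "expected_trace_D2 (\<lambda>u w. dl u w x xs) x xs < 0"
  shows "g_loss dl x xs \<bullet> xs = - norm (g_loss dl x xs) * sin (angle x xs)
    \<and> RGA 1 1 (g_loss dl x xs) x xs"
proof -
  define g where "g = g_loss dl x xs"
  define c where "c = x \<bullet> xs"
  define s where "s = sin (angle x xs)"
  have nx: "norm x = 1" and nxs: "norm xs = 1" using x xs by simp_all
  then have xx: "x \<bullet> x = 1" "xs \<bullet> xs = 1" by (simp_all add: norm_eq_1)
  have "\<bar>c\<bar> \<le> 1" using Cauchy_Schwarz_ineq2[of x xs] by (simp add: c_def nx nxs)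
  then have cos: "cos (angle x xs) = c" by (simp add: angle_def c_def cos_arccos_abs)
  have s: "0 < s" using angle by (auto simp: s_def intro!: sin_gt_zero)
  have s2: "s\<^sup>2 = 1 - c\<^sup>2" by (simp add: s_def cos[symmetric] sin_squared_eq)
  have c: "\<bar>x \<bullet> xs\<bar> < 1"
    using s s2 by (simp add: c_def[symmetric] abs_square_less_1[symmetric]) (smt (verit) zero_less_power)
  have dl: "(\<lambda>(u, w). dl u w x xs) \<in> borel_measurable borel"
    using selection by (simp add: partial1_selection_def)
  define t where "t = expected_trace_D2 (\<lambda>u w. dl u w x xs) x xs"
  have g_xs: "g \<bullet> xs = s\<^sup>2 * t"
    using g_loss_inner_eq_trace[OF integrable_g dl integrable_D2 nx nxs c]
    by (simp add: g_def t_def s2 c_def)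
  have g_x: "g \<bullet> x = 0"
    unfolding g_def by (rule g_loss_orthogonal_base[OF integrable_g nx])
  \<comment> \<open>Subtracting from \<open>g\<close> the tangent vector with the same products with \<open>x\<close> and \<open>xs\<close> leaves a
    vector orthogonal to both, to which \<open>g\<close> is orthogonal by symmetry; so nothing is left.\<close>
  define f where "f = g - t *\<^sub>R (xs - c *\<^sub>R x)"
  have f_x: "f \<bullet> x = 0"
    by (simp add: f_def inner_diff_left g_x xx c_def inner_commute[of xs x])
  have f_xs: "f \<bullet> xs = 0"
    by (simp add: f_def inner_diff_left g_xs xx c_def[symmetric] s2 del: mult_eq_0_iff)
       (simp add: power2_eq_square algebra_simps)
  have "g \<bullet> f = 0"
    unfolding g_def using f_x f_xs by (rule g_loss_orthogonal_complement[OF integrable_g dl])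
  moreover have "f \<bullet> f = f \<bullet> g - t * (f \<bullet> xs - c * (f \<bullet> x))"
    by (subst (2) f_def) (simp add: inner_diff_right)
  ultimately have "f \<bullet> f = 0"
    using f_x f_xs by (simp add: inner_commute)
  then have g: "g = t *\<^sub>R (xs - c *\<^sub>R x)" by (simp add: f_def)
  have "g \<bullet> g = (t * s)\<^sup>2"
    using g_xs g_x by (subst (2) g) (simp add: inner_diff_right power2_eq_square)
  then have norm_g: "norm g = - t * s"
    using trace_neg s by (simp add: norm_eq_sqrt_inner t_def abs_mult)
  have "g \<bullet> xs = - norm g * s"
    by (simp add: g_xs norm_g power2_eq_square)
  moreover have "g \<noteq> 0"
    using norm_g trace_neg s by (auto simp: t_def)
  ultimately show ?thesis
    using s g_x by (simp add: RGA_def g_def s_def)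
qed

end
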